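(* Let $n\geq 1$, let $u$ and $v$ be two snakeshapes of size $n$, and let $\hat 1$ be the maximal tableau in the poset $(\mathbb{YFT}_n,\preceq)$ of standard Young-Fibonacci tableaux of size $n$. Then Okada's Young-Fibonacci analogue of the Kostka number, $\mathbf K_{u,v}$, is the number of tableaux $t$ of shape $u$ in the interval $[rT_v,\hat 1]$ of $(\mathbb{YFT}_n,\preceq)$.
   Context: **Snakeshapes and lattice.** A snakeshape of size $n$ is a word $u=u_1\cdots u_k$ with letters in $\{1,2\}$ and sum $n$ (the empty word $\emptyset$ for $n=0$), drawn as $k$ bottom-justified columns from left to right, the $i$-th column having $u_i$ boxes; in a single-boxed column the unique box is both bottom and top box. In the Young-Fibonacci lattice, a snakeshape $u$ is covered exactly by: (1) $1u$; (2) the snakeshape obtained by adding a box on top of the first (leftmost) single-boxed column of $u$, if there is one; (3) if $u$ starts with a (maximal) series of two-boxed columns, every snakeshape obtained by inserting a single-boxed column just after one of the columns of this initial series. Write $w\rhd u$ if $w$ covers $u$. **Okada's analogue of Kostka numbers.** These are the coefficients in $\mathbf h_v=\sum_u\mathbf K_{u,v}\,\mathbf s_u$ expressing Okada's analogue of complete symmetric functions in terms of his analogue of Schur functions; they are defined for pairs of snakeshapes of the same size and are determined by $\mathbf K_{\emptyset,\emptyset}=1$ and the recurrences $$\mathbf K_{1u,1v}=\mathbf K_{u,v},\quad \mathbf K_{2u,2v}=\mathbf K_{u,v},\quad \mathbf K_{1u,2v}=0,\quad \mathbf K_{2u,1v}=\sum_{w\rhd u}\mathbf K_{w,v}.$$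 **Tableaux.** A standard Young-Fibonacci tableau of size $n$ is a numbering of a snakeshape of size $n$ with $1,\dots,n$ (each used once) such that in each two-boxed column the top entry is larger than the bottom entry, and the entry in the top box of any column is larger than all entries in the columns to its right. $\mathbb{YFT}_n$ is the set of these. **Row canonical tableau.** $rT_v$ is the tableau of shape $v$ in which the top boxes of all columns (including the boxes of single-boxed columns) are labeled $n,n-1,\dots$ from left to right, and the bottom boxes of the two-boxed columns are labeled $1,2,\dots$ from left to right. **Shifting an entry.** Let $a$ be the bottom entry of a column of $t$ which is not the first column; let $b$ be the entry on top of $a$, if the column of $a$ is two-boxed. A shift of $a$ is possible in the following cases and modifies only the column of $a$ and the column just to its left. (1) The column just to the left of $a$ is single-boxed with entry $c$. Then these columns are replaced by a two-boxed column with bottom $a$ and top $c$, followed (if $b$ exists) by a single-boxed column $b$. (2) The column just to the left of $a$ is two-boxed with bottom $c$ and top $d$, and $a<c$. If $b$ exists and $c<b$, the two columns are replaced by the two-boxed column (bottom $a$, top $d$) followed by the two-boxed column (bottom $c$, top $b$). Otherwise they are replaced by the two-boxed column (bottom $a$, top $d$), followed by a single-boxed column $c$, followed (if $b$ exists) by a single-boxed column $b$. **Order.** $t\preceq t'$ if there is a sequence $t_0=t,t_1,\dots,t_k=t'$ ($k\ge0$) in $\mathbb{YFT}_n$ such that $t_{i+1}$ is obtained from $t_i$ by shifting an entry, for $0\le i\le k-1$. This is a partial order on $\mathbb{YFT}_n$ and it has a greatest element $\hat1$. The interval $[s,s']$ is $\{t: s\preceq t\preceq s'\}$. *)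

theory Defs
  imports Main
begin

datatype letter = L1 | L2

type_synonym snakeshape = "letter list"

primrec boxes :: "letter \<Rightarrow> nat" where
  "boxes L1 = 1"
| "boxes L2 = 2"

definition snake_size :: "snakeshape \<Rightarrow> nat" where
  "snake_size u = sum_list (map boxes u)"

text \<open>\<open>covers w u\<close> is the relation \<open>w \<rhd> u\<close> of the Young-Fibonacci lattice.\<close>

inductive covers :: "snakeshape \<Rightarrow> snakeshape \<Rightarrow> bool" where
  prepend: "covers (L1 # u) u"
| add_box: "covers (replicate k L2 @ L2 # x) (replicate k L2 @ L1 # x)"
| insert_single: "1 \<le> j \<Longrightarrow> covers (replicate j L2 @ L1 # x) (replicate j L2 @ x)"

text \<open>Okada's analogue of the Kostka numbers, given by the recurrences that determine them.
  They are meaningful for shapes of equal size only: the last two equations, for exactly one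
  empty argument, only make the function total.\<close>

fun kostka :: "snakeshape \<Rightarrow> snakeshape \<Rightarrow> nat" where
  "kostka [] [] = 1"
| "kostka (L1 # u) (L1 # v) = kostka u v"
| "kostka (L2 # u) (L2 # v) = kostka u v"
| "kostka (L1 # u) (L2 # v) = 0"
| "kostka (L2 # u) (L1 # v) = (\<Sum>w | covers w u. kostka w v)"
| "kostka [] (_ # _) = 0"
| "kostka (_ # _) [] = 0"

text \<open>\<open>Double a b\<close> is the two-boxed column with bottom entry \<open>a\<close> and top entry \<open>b\<close>.\<close>

datatype column = Single nat | Double nat nat

primrec col_letter :: "column \<Rightarrow> letter" where
  "col_letter (Single a) = L1"
| "col_letter (Double a b) = L2"

primrec col_entries :: "column \<Rightarrow> nat list" where
  "col_entries (Single a) = [a]"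
| "col_entries (Double a b) = [a, b]"

primrec top_entry :: "column \<Rightarrow> nat" where
  "top_entry (Single a) = a"
| "top_entry (Double a b) = b"

type_synonym tableau = "column list"

definition shape :: "tableau \<Rightarrow> snakeshape" where
  "shape t = map col_letter t"

definition entries :: "tableau \<Rightarrow> nat list" where
  "entries t = concat (map col_entries t)"

definition YFT :: "nat \<Rightarrow> tableau set" where
  "YFT n = {t. distinct (entries t) \<and> set (entries t) = {1..n} \<and>
     (\<forall>a b. Double a b \<in> set t \<longrightarrow> a < b) \<and>
     (\<forall>i j. i < j \<and> j < length t \<longrightarrow> (\<forall>x \<in> set (col_entries (t ! j)). x < top_entry (t ! i)))}"

text \<open>In \<open>row_canonical_from m k v\<close>, \<open>m\<close> is the next top label and \<open>k\<close> the next bottom label.\<close>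

primrec row_canonical_from :: "nat \<Rightarrow> nat \<Rightarrow> snakeshape \<Rightarrow> tableau" where
  "row_canonical_from m k [] = []"
| "row_canonical_from m k (l # v) = (case l of
      L1 \<Rightarrow> Single m # row_canonical_from (m - 1) k v
    | L2 \<Rightarrow> Double k m # row_canonical_from (m - 1) (k + 1) v)"

definition row_canonical :: "snakeshape \<Rightarrow> tableau" where
  "row_canonical v = row_canonical_from (snake_size v) 1 v"

text \<open>\<open>shift t t'\<close>: \<open>t'\<close> is obtained from \<open>t\<close> by shifting an entry.\<close>

inductive shift :: "tableau \<Rightarrow> tableau \<Rightarrow> bool" where
  single_single:
    "shift (xs @ [Single c, Single a] @ ys) (xs @ [Double a c] @ ys)"
| single_double:
    "shift (xs @ [Single c, Double a b] @ ys) (xs @ [Double a c, Single b] @ ys)"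
| double_double_less:
    "a < c \<Longrightarrow> c < b \<Longrightarrow>
     shift (xs @ [Double c d, Double a b] @ ys) (xs @ [Double a d, Double c b] @ ys)"
| double_double_not_less:
    "a < c \<Longrightarrow> \<not> c < b \<Longrightarrow>
     shift (xs @ [Double c d, Double a b] @ ys) (xs @ [Double a d, Single c, Single b] @ ys)"
| double_single:
    "a < c \<Longrightarrow>
     shift (xs @ [Double c d, Single a] @ ys) (xs @ [Double a d, Single c] @ ys)"

definition yft_le :: "nat \<Rightarrow> tableau \<Rightarrow> tableau \<Rightarrow> bool" where
  "yft_le n t t' \<longleftrightarrow>
     t \<in> YFT n \<and> (\<lambda>s s'. s \<in> YFT n \<and> s' \<in> YFT n \<and> shift s s')\<^sup>*\<^sup>* t t'"

definition yft_interval :: "nat \<Rightarrow> tableau \<Rightarrow> tableau \<Rightarrow> tableau set" where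
  "yft_interval n s s' = {t. yft_le n s t \<and> yft_le n t s'}"

definition yft_top :: "nat \<Rightarrow> tableau" where
  "yft_top n = (THE m. m \<in> YFT n \<and> (\<forall>t \<in> YFT n. yft_le n t m))"

end

theory Submission
  imports Defs
begin

text \<open>Removing the largest entry of a tableau is an operation \<open>del\<close> adjoint to adding a new
  largest entry \<open>m\<close> as a single-boxed first column: \<open>Single m # s \<preceq> t\<close> iff \<open>s \<preceq> del t\<close>, for \<open>t\<close> with
  largest entry \<open>m\<close>. On the tableaux of shape \<open>2u\<close> it is a bijection onto the tableaux whose shape
  covers \<open>u\<close>, which gives the recurrence for \<open>K(2u,1v)\<close>, and the one for \<open>K(1u,1v)\<close> is immediate.
  A two-boxed first column whose bottom is the smallest entry is never changed by a shift,
  which gives the recurrences for \<open>K(\<cdot>,2v)\<close>. Every tableau lies below the greatest one because the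
  smallest entry can always be shifted to the first column.\<close>

section \<open>Shifts\<close>

abbreviation shifts :: "tableau \<Rightarrow> tableau \<Rightarrow> bool" where
  "shifts \<equiv> shift\<^sup>*\<^sup>*"

lemmas shift_head =
  shift.single_single[of "[]", simplified]
  shift.single_double[of "[]", simplified]
  shift.double_double_less[of _ _ _ "[]", simplified]
  shift.double_double_not_less[of _ _ _ "[]", simplified]
  shift.double_single[of _ _ "[]", simplified]

lemma shift_Cons: "shift s t \<Longrightarrow> shift (x # s) (x # t)"
proof (induction rule: shift.induct)
  case (single_single xs c a ys)
  then show ?case using shift.single_single[of "x # xs"] by simp
next
  case (single_double xs c a b ys)
  then show ?case using shift.single_double[of "x # xs"] by simp
next
  case (double_double_less a c b xs d ys)
  then show ?case using shift.double_double_less[where xs = "x # xs"] by simp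
next
  case (double_double_not_less a c b xs d ys)
  then show ?case using shift.double_double_not_less[where xs = "x # xs"] by simp
next
  case (double_single a c xs d ys)
  then show ?case using shift.double_single[where xs = "x # xs"] by simp
qed

text \<open>Trades the prefix \<open>xs\<close> in the rules of \<open>shift\<close> for a
  recursion: either the first two columns change, or the first column is kept. This matches
  functions that recurse on columns, such as \<open>tab\<close> and \<open>del\<close>.\<close>

lemma shift_head_induct [consumes 1, case_names
    single_single single_double double_double_less double_double_not_less double_single Cons]:
  assumes "shift s t"
    and "\<And>c a ys. P (Single c # Single a # ys) (Double a c # ys)"
    and "\<And>c a b ys. P (Single c # Double a b # ys) (Double a c # Single b # ys)"
    and "\<And>c d a b ys. a < c \<Longrightarrow> c < b \<Longrightarrow>
      P (Double c d # Double a b # ys) (Double a d # Double c b # ys)"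
    and "\<And>c d a b ys. a < c \<Longrightarrow> \<not> c < b \<Longrightarrow>
      P (Double c d # Double a b # ys) (Double a d # Single c # Single b # ys)"
    and "\<And>c d a ys. a < c \<Longrightarrow> P (Double c d # Single a # ys) (Double a d # Single c # ys)"
    and Cons: "\<And>x s t. shift s t \<Longrightarrow> P s t \<Longrightarrow> P (x # s) (x # t)"
  shows "P s t"
proof -
  have prefix: "shift (xs @ s) (xs @ t) \<and> P (xs @ s) (xs @ t)" if "shift s t" "P s t" for xs s t
    using that by (induction xs) (auto intro: shift_Cons Cons)
  show ?thesis
    using assms(1)
    by cases (simp only: append_Cons append_Nil, rule prefix[THEN conjunct2];
        (rule shift_head assms(2-6); simp))+
qed

lemma shifts_Cons: "shifts s t \<Longrightarrow> shifts (x # s) (x # t)"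
  by (induction rule: rtranclp_induct) (auto intro: shift_Cons rtranclp.rtrancl_into_rtrancl)

lemma entries_simps [simp]: "entries [] = []" "entries (x # t) = col_entries x @ entries t"
  by (simp_all add: entries_def)

lemma shape_simps [simp]: "shape [] = []" "shape (x # t) = col_letter x # shape t"
  by (simp_all add: shape_def)

lemma entries_Nil_iff [simp]: "entries t = [] \<longleftrightarrow> t = []"
  by (cases t; cases "hd t") auto

lemma shift_entries: "shift s t \<Longrightarrow> set (entries t) = set (entries s)"
  by (induction rule: shift_head_induct) auto

lemma shift_nonempty: "shift s t \<Longrightarrow> s \<noteq> [] \<and> t \<noteq> [] \<and> top_entry (hd t) = top_entry (hd s)"
  by (induction rule: shift_head_induct) auto

lemma shifts_entries: "shifts s t \<Longrightarrow> set (entries t) = set (entries s)"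
  by (induction rule: rtranclp_induct) (auto simp: shift_entries)

lemma shifts_top_hd:
  "shifts s t \<Longrightarrow> s \<noteq> [] \<Longrightarrow> t \<noteq> [] \<and> top_entry (hd t) = top_entry (hd s)"
  by (induction rule: rtranclp_induct) (auto dest: shift_nonempty)

lemma shifts_Nil: "shifts [] t \<longleftrightarrow> t = []"
  by (auto elim: converse_rtranclpE dest: shift_nonempty)

text \<open>Recursive form of the conditions in \<open>YFT\<close>; \<open>S\<close> stands for the
  entries to the right of the column. The top entry differs from these by being larger, so
  distinctness only asks for \<open>a \<notin> S\<close>.\<close>

primrec tab_col :: "column \<Rightarrow> nat set \<Rightarrow> bool" where
  "tab_col (Single a) S \<longleftrightarrow> (\<forall>x\<in>S. x < a)"
| "tab_col (Double a b) S \<longleftrightarrow> a < b \<and> a \<notin> S \<and> (\<forall>x\<in>S. x < b)"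

primrec tab :: "tableau \<Rightarrow> bool" where
  "tab [] \<longleftrightarrow> True"
| "tab (x # t) \<longleftrightarrow> tab_col x (set (entries t)) \<and> tab t"

lemma tab_iff:
  "tab t \<longleftrightarrow> distinct (entries t) \<and> (\<forall>a b. Double a b \<in> set t \<longrightarrow> a < b) \<and>
     (\<forall>i j. i < j \<and> j < length t \<longrightarrow> (\<forall>x \<in> set (col_entries (t ! j)). x < top_entry (t ! i)))"
proof (induction t)
  case (Cons c t)
  have "(\<forall>i j. i < j \<and> j < length (c # t) \<longrightarrow>
      (\<forall>x \<in> set (col_entries ((c # t) ! j)). x < top_entry ((c # t) ! i))) \<longleftrightarrow>
    (\<forall>x \<in> set (entries t). x < top_entry c) \<and>
    (\<forall>i j. i < j \<and> j < length t \<longrightarrow> (\<forall>x \<in> set (col_entries (t ! j)). x < top_entry (t ! i)))"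
    (is "?L \<longleftrightarrow> ?A \<and> ?B")
  proof
    assume L: ?L
    have ?A
    proof
      fix x assume "x \<in> set (entries t)"
      then obtain d where "d \<in> set t" and x: "x \<in> set (col_entries d)"
        by (auto simp: entries_def)
      then obtain j where "j < length t" "t ! j = d"
        by (auto simp: in_set_conv_nth)
      then show "x < top_entry c"
        using L[rule_format, of 0 "Suc j" x] x by simp
    qed
    moreover have ?B
      using L[rule_format, of "Suc i" "Suc j" for i j] by simp
    ultimately show "?A \<and> ?B" ..
  next
    assume R: "?A \<and> ?B"
    show ?L
    proof (intro allI impI ballI)
      fix i j x
      assume ij: "i < j \<and> j < length (c # t)" and x: "x \<in> set (col_entries ((c # t) ! j))"
      then obtain j' where j': "j = Suc j'" "j' < length t" by (cases j) auto
      then have "x \<in> set (entries t)"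
        using x nth_mem[of j' t] by (auto simp: entries_def)
      then show "x < top_entry ((c # t) ! i)"
        using R ij x j' by (cases i) auto
    qed
  qed
  then show ?case
    using Cons.IH by (cases c) auto
qed simp

lemma YFT_iff: "t \<in> YFT n \<longleftrightarrow> tab t \<and> set (entries t) = {1..n}"
  by (auto simp: YFT_def tab_iff)

lemma tab_shift: "shift s t \<Longrightarrow> tab s \<Longrightarrow> tab t"
proof (induction rule: shift_head_induct)
  case (Cons x s t)
  then show ?case
    using shift_entries[of s t] by simp
qed auto

lemma tab_shifts: "shifts s t \<Longrightarrow> tab s \<Longrightarrow> tab t"
  by (induction rule: rtranclp_induct) (auto intro: tab_shift)

text \<open>Shifts preserve \<open>tab\<close> and the set of entries, so a chain of shifts starting
  in \<open>YFT n\<close> never leaves it.\<close>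

lemma yft_le_iff: "yft_le n s t \<longleftrightarrow> s \<in> YFT n \<and> shifts s t"
proof -
  have "(\<lambda>s s'. s \<in> YFT n \<and> s' \<in> YFT n \<and> shift s s')\<^sup>*\<^sup>* s t" if "shifts s t" "s \<in> YFT n"
    using that
  proof (induction rule: rtranclp_induct)
    case (step t t')
    have "t \<in> YFT n \<and> t' \<in> YFT n"
      using step tab_shifts[of s t] shifts_entries[of s t] tab_shift[of t t'] shift_entries[of t t']
      by (simp add: YFT_iff)
    with step show ?case
      by (auto intro: rtranclp.rtrancl_into_rtrancl)
  qed simp
  moreover have "shifts s t" if "(\<lambda>s s'. s \<in> YFT n \<and> s' \<in> YFT n \<and> shift s s')\<^sup>*\<^sup>* s t"
    using that by (rule rtranclp_mono[THEN predicate2D, rotated]) auto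
  ultimately show ?thesis
    by (auto simp: yft_le_def)
qed

section \<open>The greatest tableau\<close>

primrec bottom_entry :: "column \<Rightarrow> nat" where
  "bottom_entry (Single a) = a"
| "bottom_entry (Double a b) = a"

text \<open>At the leftmost changed column the shifted entry \<open>a\<close> replaces a larger
  bottom entry \<open>c\<close>: \<open>a < c\<close> is a premise of the rule if that column is
  two-boxed, and follows from \<open>tab\<close> if it is single-boxed.\<close>

lemma shift_lexord:
  "shift s t \<Longrightarrow> tab s \<Longrightarrow> (map bottom_entry t, map bottom_entry s) \<in> lexord {(x, y). x < y}"
  by (induction rule: shift_head_induct) auto

text \<open>A nontrivial cycle of shifts would make the word of bottom entries lexicographically
  smaller than itself.\<close>

lemma shifts_antisym:
  assumes "tab s" "shifts s t" "shifts t s"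
  shows "s = t"
proof (rule ccontr)
  assume "s \<noteq> t"
  have "(map bottom_entry t', map bottom_entry s) \<in> lexord {(x, y). x < y}" if "shift\<^sup>+\<^sup>+ s t'" for t'
    using that
  proof (induction rule: tranclp_induct)
    case (base t')
    then show ?case using shift_lexord assms(1) by blast
  next
    case (step t t')
    have "tab t" using tab_shifts step(1) assms(1) by (blast dest: tranclp_into_rtranclp)
    then show ?case
      using shift_lexord[of t t'] step
      by (auto intro: lexord_trans simp: trans_def)
  qed
  moreover have "shift\<^sup>+\<^sup>+ s s"
    using assms(2,3) \<open>s \<noteq> t\<close> by (meson rtranclpD tranclp_rtranclp_tranclp)
  ultimately show False
    using lexord_irreflexive[of "{(x, y). x < (y::nat)}"] by blast
qed

text \<open>The minimum is smaller than every bottom entry to its left, so it can be shifted again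
  and again until it reaches the first column. Only the tableau with one box ends otherwise.\<close>

lemma shifts_min_to_front:
  assumes "tab t" "a \<in> set (entries t)" "\<And>x. x \<in> set (entries t) \<Longrightarrow> a \<le> x" "t \<noteq> [Single a]"
  shows "\<exists>b s. shifts t (Double a b # s)"
  using assms
proof (induction t)
  case (Cons c t)
  show ?case
  proof (cases "a \<in> set (entries t)")
    case False
    with Cons.prems have "a \<in> set (col_entries c)" by simp
    moreover have "top_entry c \<noteq> a"
    \<comment> \<open>A minimal top entry leaves nothing to its right and nothing below it, which is
      the excluded \<open>[Single a]\<close>.\<close>
    proof
      assume *: "top_entry c = a"
      have "x < a \<and> a \<le> x" if "x \<in> set (entries t)" for x
        using that * Cons.prems(1) Cons.prems(3)[of x] by (cases c) auto
      then have "set (entries t) = {}"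
        by (metis equals0I leD)
      then have "t = []"
        by simp
      with * Cons.prems show False
        by (cases c) force+
    qed
    ultimately obtain b where "c = Double a b"
      by (cases c) auto
    then show ?thesis by blast
  next
    case True
    have c: "\<exists>e s. shift (c # d # r) (Double a e # s)" if "bottom_entry d = a" for d r
    proof (cases c)
      case (Single e)
      with that show ?thesis
        by (cases d) (auto intro: shift_head)
    next
      case (Double e f)
      then have "a < e"
        using Cons.prems(1,3) True by (metis (no_types, lifting) append_Cons col_entries.simps(2)
            entries_simps(2) le_neq_implies_less list.set_intros(1) tab.simps(2) tab_col.simps(2))
      show ?thesis
      proof (cases d)
        case (Double a' b)
        then show ?thesis
          using \<open>c = Double e f\<close> \<open>a < e\<close> that shift_head(3,4)[of a e b] by (cases "e < b") auto
      qed (use Double \<open>a < e\<close> that in \<open>auto intro: shift_head\<close>)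
    qed
    show ?thesis
    \<comment> \<open>The induction hypothesis excludes this tail; here a single shift already
      suffices.\<close>
    proof (cases "t = [Single a]")
      case True
      then show ?thesis using c[of "Single a" "[]"] by auto
    next
      case False
      then obtain b s where "shifts t (Double a b # s)"
        using Cons True by auto
      then have "shifts (c # t) (c # Double a b # s)"
        by (rule shifts_Cons)
      with c[of "Double a b" s] show ?thesis
        by (meson bottom_entry.simps(2) rtranclp.rtrancl_into_rtrancl)
    qed
  qed
qed simp

text \<open>Every tableau with at least two entries can be shifted to one whose first column has the
  minimum of \<open>S\<close> below its maximum. The remaining columns are then raised to the
  greatest tableau on the remaining entries.\<close>

lemma ex_greatest_tableau:
  assumes "finite S"
  shows "\<exists>M. \<forall>t. tab t \<and> set (entries t) = S \<longrightarrow> shifts t M"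
  using assms
proof (induction S rule: finite_psubset_induct)
  case (psubset S)
  show ?case
  proof (cases "S = {}")
    case True
    then show ?thesis by auto
  next
    case False
    define a where "a = Min S"
    have a: "a \<in> S" "\<And>x. x \<in> S \<Longrightarrow> a \<le> x"
      using False psubset.hyps by (simp_all add: a_def)
    let ?b = "Max S"
    have sub: "S - {a, ?b} \<subset> S"
      using a by blast
    then obtain M where M: "\<And>t. tab t \<Longrightarrow> set (entries t) = S - {a, ?b} \<Longrightarrow> shifts t M"
      using psubset.IH[OF sub] by auto
    \<comment> \<open>For \<open>S = {a}\<close> minimum and maximum coincide and the only tableau
      is the single box.\<close>
    have "shifts t (if S = {a} then [Single a] else Double a ?b # M)"
      if t: "tab t" "set (entries t) = S" for t
    proof (cases "t = [Single a]")
      case True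
      then show ?thesis using t by auto
    next
      case False
      then obtain b s where bs: "shifts t (Double a b # s)"
        using shifts_min_to_front[of t a] t a by auto
      then have tab: "tab (Double a b # s)" and S: "S = {a, b} \<union> set (entries s)"
        using tab_shifts[OF bs] shifts_entries[OF bs] t by auto
      \<comment> \<open>The top of the first column is always the largest entry, so this column does
        not depend on \<open>t\<close>.\<close>
      have "?b = b"
        by (rule Max_eqI) (use psubset.hyps tab S in \<open>auto simp: less_imp_le\<close>)
      then have "set (entries s) = S - {a, ?b}"
        using tab S by auto
      then have "shifts (Double a b # s) (Double a ?b # M)"
        using M tab \<open>?b = b\<close> by (auto intro: shifts_Cons)
      moreover have "S \<noteq> {a}"
        using S tab by auto
      ultimately show ?thesis using bs by auto
    qed
    then show ?thesis by blast
  qed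
qed

lemma yft_le_top:
  assumes "t \<in> YFT n"
  shows "yft_le n t (yft_top n)"
proof -
  obtain M where M: "\<And>t. t \<in> YFT n \<Longrightarrow> yft_le n t M"
    using ex_greatest_tableau[of "{1..n}"] by (auto simp: yft_le_iff YFT_iff)
  then have "M \<in> YFT n"
    using assms tab_shifts shifts_entries by (fastforce simp: yft_le_iff YFT_iff)
  \<comment> \<open>Antisymmetry gives the uniqueness that the description in \<open>yft_top\<close>
    requires.\<close>
  then have "\<exists>!m. m \<in> YFT n \<and> (\<forall>t \<in> YFT n. yft_le n t m)"
    using M by (metis YFT_iff shifts_antisym yft_le_iff)
  from theI'[OF this] assms show ?thesis
    by (simp add: yft_top_def)
qed

section \<open>Removing the largest entry\<close>

text \<open>In terms of Young-Fibonacci insertion, \<open>del\<close> deletes the largest letter from any word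
  inserting to the tableau.\<close>

fun del :: "tableau \<Rightarrow> tableau" where
  "del [] = []"
| "del (Single m # t) = t"
| "del [Double a m] = [Single a]"
| "del (Double a m # c # t) =
    (if top_entry c < a then Single a # c # t else Double a (top_entry c) # del (c # t))"

lemma del_nonempty:
  "t \<noteq> [] \<Longrightarrow> del (Double a m # t) =
    (if top_entry (hd t) < a then Single a # t else Double a (top_entry (hd t)) # del t)"
  by (cases t) auto

text \<open>The counit of the adjunction. If \<open>del\<close> has moved the top of
  \<open>c\<close> above \<open>a\<close>, shifting \<open>a\<close> under \<open>m\<close> leaves
  this top as a single-boxed column in front of \<open>del (c # t)\<close>, and the argument repeats
  one column further right.\<close>

lemma shifts_Single_del: "t \<noteq> [] \<Longrightarrow> shifts (Single (top_entry (hd t)) # del t) t"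
proof (induction t rule: del.induct)
  case (3 a m)
  then show ?case using shift_head(1)[of m a "[]"] by auto
next
  case (4 a m c t)
  show ?case
  proof (cases "top_entry c < a")
    case True
    then show ?thesis using shift_head(1) by auto
  next
    case False
    have "shift (Single m # Double a (top_entry c) # del (c # t))
        (Double a m # Single (top_entry c) # del (c # t))"
      by (rule shift_head)
    also have "shifts \<dots> (Double a m # c # t)"
      using 4 False by (auto intro: shifts_Cons)
    finally show ?thesis using False by simp
  qed
qed auto

text \<open>Monotonicity of \<open>del\<close>. If the left column is single-boxed, both sides have
  the same image. Otherwise the images of the changed columns differ by one shift, except in one
  subcase of \<open>double_double_less\<close>.\<close>

lemma shifts_del_shift: "shift s t \<Longrightarrow> tab s \<Longrightarrow> shifts (del s) (del t)"
proof (induction rule: shift_head_induct)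
  case (single_single c a ys)
  then show ?case
    by (cases ys; cases "hd ys") auto
next
  case (double_double_less c d a b ys)
  show ?case
  proof (cases ys)
    case Nil
    then show ?thesis using double_double_less by (auto intro: shift_head)
  next
    case (Cons y zs)
    let ?e = "top_entry y"
    have neq: "a \<noteq> ?e" "c \<noteq> ?e"
      using double_double_less Cons by (cases y; auto)+
    consider "?e < a" | "a < ?e" "?e < c" | "c < ?e"
      using neq by linarith
    then show ?thesis
    proof cases
      \<comment> \<open>The exceptional subcase: \<open>del\<close> stops at \<open>c\<close> on the
        right-hand side but continues past \<open>a\<close> on the left-hand side. Shifting
        \<open>a\<close> frees \<open>?e\<close> as a single-boxed column in front of
        \<open>del ys\<close>, and the counit rebuilds \<open>ys\<close> from these.\<close>
      case 2
      have "shift (Double c b # Double a ?e # del ys) (Double a b # Single c # Single ?e # del ys)"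
        using 2 double_double_less by (auto intro: shift_head)
      also have "shifts \<dots> (Double a b # Single c # ys)"
        using shifts_Single_del[of ys] Cons by (auto intro: shifts_Cons)
      finally show ?thesis
        using 2 double_double_less Cons by simp
    qed (use double_double_less Cons in \<open>auto intro!: r_into_rtranclp shift_head\<close>)
  qed
next
  case (double_double_not_less c d a b ys)
  then show ?case
    by (auto intro: shift_head)
next
  case (Cons x s t)
  have "shifts (del s) (del t)"
    using Cons by simp
  \<comment> \<open>A shift keeps the top of the first column, so \<open>del\<close> takes the same
    branch on \<open>x # s\<close> and \<open>x # t\<close>.\<close>
  then show ?case
    using Cons.hyps shift_nonempty[OF Cons.hyps]
    by (cases x) (auto simp: del_nonempty intro: shifts_Cons shift_Cons)
qed (auto intro: shift_head)

lemma shifts_del: "shifts s t \<Longrightarrow> tab s \<Longrightarrow> shifts (del s) (del t)"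
proof (induction rule: rtranclp_induct)
  case (step t t')
  then show ?case
    using shifts_del_shift[of t t'] tab_shifts[of s t] by auto
qed simp

text \<open>The adjunction: apply the monotone \<open>del\<close> in one direction, and compose with
  the counit in the other.\<close>

lemma shifts_Single_iff:
  assumes "tab (Single m # s)"
  shows "shifts (Single m # s) t \<longleftrightarrow> t \<noteq> [] \<and> top_entry (hd t) = m \<and> shifts s (del t)"
proof
  assume "shifts (Single m # s) t"
  then show "t \<noteq> [] \<and> top_entry (hd t) = m \<and> shifts s (del t)"
    using shifts_del[of "Single m # s" t] shifts_top_hd[of "Single m # s" t] assms by simp
next
  assume R: "t \<noteq> [] \<and> top_entry (hd t) = m \<and> shifts s (del t)"
  then have "shifts (Single m # s) (Single m # del t)"
    by (blast intro: shifts_Cons)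
  also have "shifts \<dots> t"
    using R shifts_Single_del by blast
  finally show "shifts (Single m # s) t" .
qed

section \<open>The covering relation by recursion on the lower shape, and its match with
  \<open>del\<close>\<close>

lemma covers_Nil: "covers w [] \<longleftrightarrow> w = [L1]"
  by (auto elim: covers.cases intro: covers.prepend)

lemma covers_L1: "covers w (L1 # u) \<longleftrightarrow> w = L1 # L1 # u \<or> w = L2 # u"
proof
  assume "covers w (L1 # u)"
  then show "w = L1 # L1 # u \<or> w = L2 # u"
  proof cases
    case (add_box k x)
    then show ?thesis by (cases k) auto
  next
    case (insert_single j x)
    then show ?thesis by (cases j) auto
  qed auto
qed (use covers.prepend covers.add_box[of 0] in auto)

lemma covers_L2: "covers w (L2 # u) \<longleftrightarrow> w = L1 # L2 # u \<or> (\<exists>w'. w = L2 # w' \<and> covers w' u)"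
proof
  assume "covers w (L2 # u)"
  then show "w = L1 # L2 # u \<or> (\<exists>w'. w = L2 # w' \<and> covers w' u)"
  proof cases
    case (add_box k x)
    then show ?thesis by (cases k) (auto intro: covers.add_box)
  next
    case (insert_single j x)
    then obtain i where i: "j = Suc i" by (cases j) auto
    \<comment> \<open>Removing the leading column turns an insertion just after it
      (\<open>i = 0\<close>) into a prepended column.\<close>
    then have "covers (replicate i L2 @ L1 # x) (replicate i L2 @ x)"
      by (cases i) (auto intro: covers.prepend covers.insert_single[of "Suc _", simplified])
    with insert_single i show ?thesis by auto
  qed auto
next
  have "covers (L2 # w') (L2 # u)" if "covers w' u" for w'
    using that
  proof cases
    case prepend
    then show ?thesis using covers.insert_single[of 1] by simp
  next
    case (add_box k x)
    then show ?thesis using covers.add_box[of "Suc k"] by simp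
  next
    case (insert_single j x)
    then show ?thesis using covers.insert_single[of "Suc j"] by simp
  qed
  then show "w = L1 # L2 # u \<or> (\<exists>w'. w = L2 # w' \<and> covers w' u) \<Longrightarrow> covers w (L2 # u)"
    using covers.prepend by auto
qed

text \<open>The two branches of \<open>del\<close> on a two-boxed column produce exactly the two
  alternatives in \<open>covers_L1\<close> and \<open>covers_L2\<close>.\<close>

lemma covers_shape_del: "shape t = L2 # u \<Longrightarrow> covers (shape (del t)) u"
proof (induction t arbitrary: u rule: del.induct)
  case (4 a m c t)
  then show ?case
    by (cases c) (auto simp: covers_L1 covers_L2)
qed (auto simp: covers_Nil)

text \<open>The first column of the image tells which branch of \<open>del\<close> was taken. A
  single-boxed one leaves the tail unchanged; a two-boxed one records the top of the next column,
  which \<open>del\<close> loses from the tail.\<close>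

lemma del_inj:
  "\<lbrakk>shape s = L2 # u; shape t = L2 # u; top_entry (hd s) = top_entry (hd t); del s = del t\<rbrakk> \<Longrightarrow> s = t"
proof (induction u arbitrary: s t)
  case Nil
  then obtain a b m n where "s = [Double a m]" "t = [Double b n]"
    by (cases s; cases t; cases "hd s"; cases "hd t") (auto simp: shape_def)
  with Nil show ?case by simp
next
  case (Cons l u)
  then obtain a b m c s' d t' where st: "s = Double a m # c # s'" "t = Double b m # d # t'"
      "col_letter c = l" "col_letter d = l" "shape s' = u" "shape t' = u"
    by (cases s; cases t; cases "hd s"; cases "hd t"; cases "tl s"; cases "tl t") auto
  show ?case
  proof (cases l)
    case L1
    then show ?thesis
      using st Cons.prems by (cases c; cases d) (auto split: if_splits)
  next
    case L2
    then show ?thesis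
      using st Cons.prems Cons.IH[of "c # s'" "d # t'"] by (auto split: if_splits)
  qed
qed

text \<open>Builds the preimage by undoing \<open>del\<close> from left to right. The top
  \<open>m\<close> is arbitrary because the recursion continues with the top \<open>b\<close> of the
  current column.\<close>

lemma del_surj:
  "tab s \<Longrightarrow> covers (shape s) u \<Longrightarrow>
    \<exists>t. t \<noteq> [] \<and> shape t = L2 # u \<and> top_entry (hd t) = m \<and> del t = s"
proof (induction s arbitrary: u m)
  case Nil
  then show ?case by (auto elim: covers.cases)
next
  case (Cons c s)
  show ?case
  proof (cases c)
    case (Single a)
    then have u: "u = shape s"
      using Cons.prems by (cases u; cases "hd u") (auto simp: covers_Nil covers_L1 covers_L2)
    \<comment> \<open>This makes \<open>del\<close> stop at the first column of
      \<open>Double a m # s\<close>.\<close>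
    have "top_entry (hd s) < a" if "s \<noteq> []"
      using that Cons.prems Single by (cases s; cases "hd s") auto
    then have "del (Double a m # s) = c # s"
      using Single by (cases s) auto
    with u show ?thesis
      by (intro exI[of _ "Double a m # s"]) auto
  next
    case (Double a b)
    then consider "u = L1 # shape s" | u' where "u = L2 # u'" "covers (shape s) u'"
      using Cons.prems by (cases u; cases "hd u") (auto simp: covers_Nil covers_L1 covers_L2)
    then show ?thesis
    proof cases
      case 1
      with Double Cons.prems show ?thesis
        by (intro exI[of _ "Double a m # Single b # s"]) auto
    next
      case 2
      then obtain t where t: "t \<noteq> []" "shape t = L2 # u'" "top_entry (hd t) = b" "del t = s"
        using Cons by auto
      with Double Cons.prems 2 show ?thesis
        by (intro exI[of _ "Double a m # t"]) (auto simp: del_nonempty)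
    qed
  qed
qed

section \<open>Counting\<close>

lemma snake_size_simps [simp]:
  "snake_size [] = 0" "snake_size (l # u) = boxes l + snake_size u"
  by (simp_all add: snake_size_def)

lemma snake_size_0_iff: "snake_size u = 0 \<longleftrightarrow> u = []"
  by (cases u; cases "hd u") auto

lemma snake_size_covers: "covers w u \<Longrightarrow> snake_size w = Suc (snake_size u)"
  by (induction rule: covers.induct) (auto simp: snake_size_def)

text \<open>A cover has at most one more column. Finiteness makes the sum in \<open>kostka\<close> a
  genuine one.\<close>

lemma finite_covers: "finite {w. covers w u}"
proof -
  have "finite (UNIV :: letter set)"
    by (rule finite_subset[of _ "{L1, L2}"]) (use letter.exhaust in auto)
  then have "finite {w :: letter list. set w \<subseteq> UNIV \<and> length w \<le> Suc (length u)}"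
    by (rule finite_lists_length_le)
  moreover have "length w \<le> Suc (length u)" if "covers w u" for w
    using that by (induction rule: covers.induct) auto
  ultimately show ?thesis
    by (elim rev_finite_subset) auto
qed

lemma finite_shifts_shape: "finite {t. shifts s t \<and> shape t = u}"
proof -
  let ?E = "set (entries s)"
  let ?C = "Single ` ?E \<union> case_prod Double ` (?E \<times> ?E)"
  have "set t \<subseteq> ?C" if "shifts s t" for t
  proof
    fix c assume "c \<in> set t"
    then have "set (col_entries c) \<subseteq> ?E"
      using shifts_entries[OF that] by (auto simp: entries_def)
    then show "c \<in> ?C"
      by (cases c) auto
  qed
  moreover have "finite {t. set t \<subseteq> ?C \<and> length t = length u}"
    by (intro finite_lists_length_eq) auto
  ultimately show ?thesis
    by (elim rev_finite_subset) (auto simp: shape_def)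
qed

lemma entries_row_canonical_from:
  "m + 1 = k + snake_size v \<Longrightarrow> 1 \<le> k \<Longrightarrow> set (entries (row_canonical_from m k v)) = {k..m}"
proof (induction v arbitrary: m k)
  case (Cons l v)
  then show ?case
    by (cases l) auto
qed auto

lemma tab_row_canonical_from:
  "m + 1 = k + snake_size v \<Longrightarrow> 1 \<le> k \<Longrightarrow> tab (row_canonical_from m k v)"
proof (induction v arbitrary: m k)
  case (Cons l v)
  then show ?case
    by (cases l) (auto simp: entries_row_canonical_from)
qed auto

text \<open>Changing the first column would require shifting an entry smaller than \<open>k\<close>
  into it, so all shifts take place in the tail.\<close>

lemma shifts_Double_iff:
  assumes "\<And>x. x \<in> set (entries s) \<Longrightarrow> k \<le> x"
  shows "shifts (Double k m # s) t \<longleftrightarrow> (\<exists>s'. t = Double k m # s' \<and> shifts s s')"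
proof
  have first: "\<exists>s''. t' = Double k m # s'' \<and> shift s' s''"
    if "shift t t'" "t = Double k m # s'" "\<forall>x\<in>set (entries s'). k \<le> x" for t t' s'
    using that by (induction rule: shift_head_induct) auto
  assume "shifts (Double k m # s) t"
  then show "\<exists>s'. t = Double k m # s' \<and> shifts s s'"
  proof (induction rule: rtranclp_induct)
    case (step t t')
    then obtain s' where s': "t = Double k m # s'" "shifts s s'" by blast
    have "\<forall>x\<in>set (entries s'). k \<le> x"
      using shifts_entries[OF s'(2)] assms by auto
    with first[OF step(2) s'(1)] s' show ?case by (auto intro: rtranclp.rtrancl_into_rtrancl)
  qed auto
qed (auto intro: shifts_Cons)

text \<open>By the adjunction, \<open>t\<close> lies above \<open>Single m # s\<close> iff
  \<open>del t\<close> lies above \<open>s\<close>, provided the top of the first column is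
  \<open>m\<close>; so \<open>del\<close> restricts to a bijection, and its images are sorted by
  shape.\<close>

lemma card_shifts_shape_L2:
  assumes "tab (Single m # s)"
  shows "card {t. shifts (Single m # s) t \<and> shape t = L2 # u} =
    (\<Sum>w | covers w u. card {t. shifts s t \<and> shape t = w})" (is "card ?A = _")
proof -
  let ?B = "{t. shifts s t \<and> covers (shape t) u}"
  have "bij_betw del ?A ?B"
  proof (rule bij_betwI')
    fix t t' assume "t \<in> ?A" "t' \<in> ?A"
    then show "del t = del t' \<longleftrightarrow> t = t'"
      using del_inj by (auto simp: shifts_Single_iff[OF assms])
  next
    fix t assume "t \<in> ?A"
    then show "del t \<in> ?B"
      using covers_shape_del by (auto simp: shifts_Single_iff[OF assms])
  next
    fix t assume "t \<in> ?B"
    then show "\<exists>t'\<in>?A. t = del t'"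
      using del_surj[of t u m] tab_shifts[of s t] assms by (auto simp: shifts_Single_iff[OF assms])
  qed
  then have "card ?A = card ?B"
    by (rule bij_betw_same_card)
  also have "?B = (\<Union>w\<in>{w. covers w u}. {t. shifts s t \<and> shape t = w})"
    by auto
  also have "card \<dots> = (\<Sum>w | covers w u. card {t. shifts s t \<and> shape t = w})"
    by (intro card_UN_disjoint) (auto simp: finite_covers finite_shifts_shape)
  finally show ?thesis .
qed

text \<open>Tails of a row canonical tableau are row canonical only up to their label range, hence
  the general \<open>m\<close> and \<open>k\<close>; \<open>u\<close> varies because the recurrence
  passes to covers.\<close>

lemma kostka_eq_card:
  "\<lbrakk>snake_size u = snake_size v; m + 1 = k + snake_size v; 1 \<le> k\<rbrakk> \<Longrightarrow>
    kostka u v = card {t. shifts (row_canonical_from m k v) t \<and> shape t = u}"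
proof (induction v arbitrary: u m k)
  case Nil
  then have "{t. shifts (row_canonical_from m k []) t \<and> shape t = u} = {[]}"
    by (auto simp: snake_size_0_iff shifts_Nil)
  with Nil show ?case
    by (simp add: snake_size_0_iff)
next
  case (Cons l v)
  note tab = tab_row_canonical_from[OF Cons.prems(2,3)]
  obtain l' u' where u: "u = l' # u'"
    using Cons.prems(1) by (cases u; cases l) auto
  show ?case
  proof (cases l)
    case L1
    define s where "s = row_canonical_from (m - 1) k v"
    have s: "row_canonical_from m k (l # v) = Single m # s"
      using L1 by (simp add: s_def)
    have tab_s: "tab (Single m # s)"
      using tab by (simp only: s)
    show ?thesis
    proof (cases l')
      case l': L1
      have "{t. shifts (Single m # s) t \<and> shape t = L1 # u'} = (#) (Single m) ` {t. shifts s t \<and> shape t = u'}"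
      proof (intro equalityI subsetI)
        fix t assume t: "t \<in> {t. shifts (Single m # s) t \<and> shape t = L1 # u'}"
        then obtain r where "t = Single m # r"
          using shifts_top_hd[of "Single m # s" t] by (cases t; cases "hd t") auto
        with t show "t \<in> (#) (Single m) ` {t. shifts s t \<and> shape t = u'}"
          by (auto simp: shifts_Single_iff[OF tab_s])
      qed (auto intro: shifts_Cons)
      then have "card {t. shifts (Single m # s) t \<and> shape t = L1 # u'} = card {t. shifts s t \<and> shape t = u'}"
        by (simp add: card_image)
      moreover have "kostka u' v = card {t. shifts s t \<and> shape t = u'}"
        by (unfold s_def, rule Cons.IH) (use Cons.prems L1 l' u in auto)
      ultimately show ?thesis
        unfolding s using L1 l' u by simp
    next
      case l': L2
      \<comment> \<open>A cover of \<open>u'\<close> has one box more than \<open>u'\<close>, hence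
        the size of \<open>v\<close>.\<close>
      have "kostka w v = card {t. shifts s t \<and> shape t = w}" if "covers w u'" for w
        by (unfold s_def, rule Cons.IH) (use Cons.prems L1 l' u snake_size_covers[OF that] in auto)
      then show ?thesis
        unfolding s unfolding u l' L1 by (simp add: card_shifts_shape_L2[OF tab_s])
    qed
  next
    case L2
    define s where "s = row_canonical_from (m - 1) (k + 1) v"
    have s: "row_canonical_from m k (l # v) = Double k m # s"
      using L2 by (simp add: s_def)
    have "k \<le> x" if "x \<in> set (entries s)" for x
      using that entries_row_canonical_from[of "m - 1" "k + 1" v] Cons.prems L2 by (auto simp: s_def)
    note iff = shifts_Double_iff[of s k m, OF this]
    show ?thesis
    proof (cases l')
      case l': L1
      have "{t. shifts (Double k m # s) t \<and> shape t = L1 # u'} = {}"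
        by (auto simp: iff)
      then show ?thesis
        unfolding s unfolding u l' L2 by (simp only: kostka.simps card.empty)
    next
      case l': L2
      have "{t. shifts (Double k m # s) t \<and> shape t = L2 # u'} = (#) (Double k m) ` {t. shifts s t \<and> shape t = u'}"
        by (auto simp: iff)
      then have "card {t. shifts (Double k m # s) t \<and> shape t = L2 # u'} = card {t. shifts s t \<and> shape t = u'}"
        by (simp add: card_image)
      moreover have "kostka u' v = card {t. shifts s t \<and> shape t = u'}"
        by (unfold s_def, rule Cons.IH) (use Cons.prems L2 l' u in auto)
      ultimately show ?thesis
        unfolding s using L2 l' u by simp
    qed
  qed
qed

theorem theorem6p2:
  fixes n :: nat and u v :: snakeshape
  assumes "n \<ge> 1" and "snake_size u = n" and "snake_size v = n"
  shows "kostka u v = card {t \<in> yft_interval n (row_canonical v) (yft_top n). shape t = u}"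
proof -
  have rT: "row_canonical v \<in> YFT n"
    using assms(3) tab_row_canonical_from[of n 1 v] entries_row_canonical_from[of n 1 v]
    by (simp add: row_canonical_def YFT_iff)
  \<comment> \<open>As the upper end is the greatest tableau, the interval is the whole up-set of
    \<open>row_canonical v\<close>.\<close>
  have "t \<in> yft_interval n (row_canonical v) (yft_top n) \<longleftrightarrow> shifts (row_canonical v) t" for t
  proof -
    have "t \<in> YFT n" if "shifts (row_canonical v) t"
      using rT tab_shifts[OF that] shifts_entries[OF that] by (simp add: YFT_iff)
    then show ?thesis
      using rT yft_le_top by (auto simp: yft_interval_def yft_le_iff)
  qed
  then show ?thesis
    using kostka_eq_card[of u v n 1] assms by (simp add: row_canonical_def)
qed

end
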